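(* For every integer $\ell$ and every real $\varepsilon>0$ there is $v_0$ such that $g(\mathbf s)\ge 1-\varepsilon$ for every deck $\mathbf s=(s_1,\dots,s_v)$ of non-negative integers with $v\ge v_0$ and $s_i\le\ell$ for every $i$.
   Context: For a sequence $\mathbf s$ of non-negative integers, the $\mathbf s$-deck has $s_i$ cards of Value $i$, with $c=s_1+\dots+s_v$ cards in total. In the $c$-round $\mathbf s$-game the deck is uniformly shuffled, and in each round the player names a value and then the top remaining card is turned; the player loses if some turned card has the value named in that round, and wins otherwise. The greedy strategy names, in every round, a value that is least frequent among the remaining cards. $g(\mathbf s)$ denotes the probability that the greedy strategy wins the $c$-round $\mathbf s$-game. *)

theory Defs
  imports "HOL-Probability.Probability"
begin

text \<open>
  A deck \<open>s = (s\<^sub>1, \<dots>, s\<^sub>v)\<close> is a list of naturals, so Value \<open>i\<close> is represented by the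
  index \<open>i - 1 < length s\<close>.
\<close>

definition deck :: "nat list \<Rightarrow> nat multiset" where
  "deck s = (\<Sum>i<length s. replicate_mset (s ! i) i)"

definition shuffle :: "nat list \<Rightarrow> nat list pmf" where
  "shuffle s = pmf_of_set (permutations_of_multiset (deck s))"

text \<open>A strategy maps the list of cards turned so far to the value named in the next round.\<close>

type_synonym strategy = "nat list \<Rightarrow> nat"

definition wins :: "strategy \<Rightarrow> nat list \<Rightarrow> bool" where
  "wins \<sigma> cs \<longleftrightarrow> (\<forall>k<length cs. cs ! k \<noteq> \<sigma> (take k cs))"

definition win_prob :: "nat list \<Rightarrow> strategy \<Rightarrow> real" where
  "win_prob s \<sigma> = measure_pmf.prob (shuffle s) {cs. wins \<sigma> cs}"

text \<open>
  \<open>least_frequent v R i\<close>: among the \<open>v\<close> values, \<open>i\<close> occurs least often in the multiset \<open>R\<close>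
  of remaining cards. All \<open>v\<close> values compete, so an exhausted value is least frequent.
\<close>

definition least_frequent :: "nat \<Rightarrow> nat multiset \<Rightarrow> nat \<Rightarrow> bool" where
  "least_frequent v R i \<longleftrightarrow> i < v \<and> (\<forall>j<v. count R i \<le> count R j)"

definition is_greedy :: "nat list \<Rightarrow> strategy \<Rightarrow> bool" where
  "is_greedy s \<sigma> \<longleftrightarrow>
     (\<forall>h. mset h \<subset># deck s \<longrightarrow> least_frequent (length s) (deck s - mset h) (\<sigma> h))"

text \<open>
  Ties are broken by an unspecified choice; \<open>win_prob_greedy_unique\<close> below shows that the
  winning probability is the same for every tie-breaking rule, even a history-dependent one.
\<close>

definition greedy_strategy :: "nat list \<Rightarrow> strategy" where
  "greedy_strategy s h = (SOME i. least_frequent (length s) (deck s - mset h) i)"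

definition greedy_win_prob :: "nat list \<Rightarrow> real" where
  "greedy_win_prob s = win_prob s (greedy_strategy s)"

lemma count_deck: "count (deck s) i = (if i < length s then s ! i else 0)"
  by (simp add: deck_def count_sum)

lemma ex_least_frequent:
  assumes "v > 0"
  shows "\<exists>i. least_frequent v R i"
proof -
  obtain i where "i \<in> {..<v}" "\<forall>j\<in>{..<v}. count R i \<le> count R j"
    using ex_is_arg_min_if_finite[of "{..<v}" "count R"] assms
    by (auto simp: is_arg_min_linorder)
  thus ?thesis by (auto simp: least_frequent_def)
qed

lemma is_greedy_greedy_strategy: "is_greedy s (greedy_strategy s)"
  unfolding is_greedy_def greedy_strategy_def
proof (intro allI impI)
  fix h assume "mset h \<subset># deck s"
  hence "deck s \<noteq> {#}" by auto
  hence "length s > 0" by (auto simp: deck_def)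
  from someI_ex[OF ex_least_frequent[OF this]]
  show "least_frequent (length s) (deck s - mset h)
    (SOME i. least_frequent (length s) (deck s - mset h) i)" .
qed

lemma wins_Cons: "wins \<sigma> (x # cs) \<longleftrightarrow> x \<noteq> \<sigma> [] \<and> wins (\<lambda>h. \<sigma> (x # h)) cs"
  by (simp add: wins_def All_less_Suc2)

lemma card_wins_rec:
  assumes "M \<noteq> {#}"
  shows "card {cs \<in> permutations_of_multiset M. wins \<sigma> cs} =
    (\<Sum>x\<in>set_mset M - {\<sigma> []}.
       card {cs \<in> permutations_of_multiset (M - {#x#}). wins (\<lambda>h. \<sigma> (x # h)) cs})"
proof -
  let ?B = "\<lambda>x. {cs \<in> permutations_of_multiset (M - {#x#}). wins (\<lambda>h. \<sigma> (x # h)) cs}"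
  have "{cs \<in> permutations_of_multiset M. wins \<sigma> cs} =
      (\<Union>x\<in>set_mset M - {\<sigma> []}. (#) x ` ?B x)"
    unfolding permutations_of_multiset_nonempty[OF assms] by (auto simp: wins_Cons)
  also have "card \<dots> = (\<Sum>x\<in>set_mset M - {\<sigma> []}. card ((#) x ` ?B x))"
    by (rule card_UN_disjoint) auto
  also have "\<dots> = (\<Sum>x\<in>set_mset M - {\<sigma> []}. card (?B x))"
    by (intro sum.cong refl card_image) auto
  finally show ?thesis .
qed

lemma card_wins_greedy:
  assumes "\<pi> permutes {..<v}" "\<And>x. count M' (\<pi> x) = count M x"
    and "\<And>h. mset h \<subset># M \<Longrightarrow> least_frequent v (M - mset h) (\<sigma> h)"
    and "\<And>h. mset h \<subset># M' \<Longrightarrow> least_frequent v (M' - mset h) (\<sigma>' h)"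
  shows "card {cs \<in> permutations_of_multiset M. wins \<sigma> cs} =
         card {cs \<in> permutations_of_multiset M'. wins \<sigma>' cs}"
  using assms
proof (induction "size M" arbitrary: M M' \<sigma> \<sigma>' \<pi>)
  case 0
  have "count M' y = 0" for y
    using 0(1) 0(3)[of "inv \<pi> y"] permutes_inverses(1)[OF 0(2)] by simp
  hence "M' = {#}" by (simp add: multiset_eq_iff)
  with 0(1) have "{cs \<in> permutations_of_multiset M. wins \<sigma> cs} = {[]}"
    "{cs \<in> permutations_of_multiset M'. wins \<sigma>' cs} = {[]}"
    by (auto simp: wins_def)
  thus ?case by simp
next
  case (Suc n)
  note \<pi> = Suc.prems(1) and cnt = Suc.prems(2)
  have M: "M \<noteq> {#}" using Suc.hyps(2) by auto
  then obtain x0 where "x0 \<in># M" by auto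
  hence M': "M' \<noteq> {#}" using cnt[of x0] by (auto simp flip: count_greater_zero_iff)
  define a where "a = \<sigma> []"
  define b where "b = \<sigma>' []"
  have a: "least_frequent v M a" and b: "least_frequent v M' b"
    using Suc.prems(3)[of "[]"] Suc.prems(4)[of "[]"] M M'
    by (auto simp: a_def b_def subset_mset.less_le)
  have pa: "\<pi> a < v" using a permutes_in_image[OF \<pi>, of a] by (simp add: least_frequent_def)
  have ib: "inv \<pi> b < v"
    using b permutes_in_image[OF permutes_inv[OF \<pi>], of b] by (simp add: least_frequent_def)
  have eq: "count M' b = count M' (\<pi> a)"
  proof (rule antisym)
    show "count M' b \<le> count M' (\<pi> a)" using b pa by (simp add: least_frequent_def)
    have "count M a \<le> count M (inv \<pi> b)" using a ib by (simp add: least_frequent_def)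
    thus "count M' (\<pi> a) \<le> count M' b"
      using cnt[of a] cnt[of "inv \<pi> b"] permutes_inverses(1)[OF \<pi>] by simp
  qed
  define \<tau> where "\<tau> = Transposition.transpose (\<pi> a) b \<circ> \<pi>"
  have \<tau>: "\<tau> permutes {..<v}"
    unfolding \<tau>_def using \<pi> pa b
    by (intro permutes_compose permutes_swap_id) (auto simp: least_frequent_def)
  have inj: "inj \<tau>" using permutes_inj[OF \<tau>] .
  have cnt': "count M' (\<tau> x) = count M x" for x
    using cnt[of x] eq by (auto simp: \<tau>_def Transposition.transpose_def)
  have \<tau>a: "\<tau> a = b" by (simp add: \<tau>_def)
  have bij: "bij_betw \<tau> (set_mset M - {a}) (set_mset M' - {b})"
  proof (rule bij_betwI')
    fix y assume y: "y \<in> set_mset M' - {b}"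
    have "\<tau> (inv \<tau> y) = y" using permutes_inverses(1)[OF \<tau>] .
    with y cnt'[of "inv \<tau> y"] \<tau>a show "\<exists>x\<in>set_mset M - {a}. y = \<tau> x"
      by (intro bexI[of _ "inv \<tau> y"]) (auto simp flip: count_greater_zero_iff)
  next
    fix x assume "x \<in> set_mset M - {a}"
    thus "\<tau> x \<in> set_mset M' - {b}"
      using cnt'[of x] \<tau>a inj by (auto simp: inj_eq simp flip: count_greater_zero_iff)
  qed (use inj in \<open>auto simp: inj_eq\<close>)
  have "card {cs \<in> permutations_of_multiset (M - {#x#}). wins (\<lambda>h. \<sigma> (x # h)) cs} =
        card {cs \<in> permutations_of_multiset (M' - {#\<tau> x#}). wins (\<lambda>h. \<sigma>' (\<tau> x # h)) cs}"
    if x: "x \<in># M" for x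
  proof (rule Suc.hyps(1))
    have x': "\<tau> x \<in># M'" using x cnt'[of x] by (simp flip: count_greater_zero_iff)
    show "n = size (M - {#x#})" using Suc.hyps(2) x by (simp add: size_Diff_singleton)
    show "\<tau> permutes {..<v}" by fact
    show "count (M' - {#\<tau> x#}) (\<tau> y) = count (M - {#x#}) y" for y
      using cnt'[of y] inj by (simp add: inj_eq)
    show "least_frequent v (M - {#x#} - mset h) (\<sigma> (x # h))" if "mset h \<subset># M - {#x#}" for h
    proof -
      obtain N where "M = add_mset x N" using x by (metis insert_DiffM)
      thus ?thesis using Suc.prems(3)[of "x # h"] that by simp
    qed
    show "least_frequent v (M' - {#\<tau> x#} - mset h) (\<sigma>' (\<tau> x # h))"
      if "mset h \<subset># M' - {#\<tau> x#}" for h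
    proof -
      obtain N where "M' = add_mset (\<tau> x) N" using x' by (metis insert_DiffM)
      thus ?thesis using Suc.prems(4)[of "\<tau> x # h"] that by simp
    qed
  qed
  thus ?case
    unfolding card_wins_rec[OF M] card_wins_rec[OF M'] a_def[symmetric] b_def[symmetric]
    by (subst sum.reindex_bij_betw[OF bij, symmetric]) (auto intro!: sum.cong)
qed

lemma win_prob_eq_card:
  "win_prob s \<sigma> = card {cs \<in> permutations_of_multiset (deck s). wins \<sigma> cs} /
                  card (permutations_of_multiset (deck s))"
  unfolding win_prob_def shuffle_def
  by (simp add: measure_pmf_of_set Int_def)

theorem win_prob_greedy_unique:
  assumes "is_greedy s \<sigma>"
  shows "win_prob s \<sigma> = greedy_win_prob s"
proof -
  have "card {cs \<in> permutations_of_multiset (deck s). wins \<sigma> cs} =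
        card {cs \<in> permutations_of_multiset (deck s). wins (greedy_strategy s) cs}"
    by (rule card_wins_greedy[of id "length s"])
       (use assms is_greedy_greedy_strategy[of s] in \<open>auto simp: is_greedy_def\<close>)
  thus ?thesis by (simp add: win_prob_eq_card greedy_win_prob_def)
qed

end

theory Submission
  imports Defs
begin

text \<open>
  Let \<open>c\<close> be the size of the deck and look at the game until \<open>r = c - \<lfloor>\<delta>c\<rfloor>\<close> cards remain. In each
  of these rounds the named value has at most \<open>l\<close> remaining cards, so losing so early has
  probability at most \<open>l(c - r)/(r + 1)\<close>, which is small with \<open>\<delta>\<close>. If some value has been
  exhausted by then, the greedy strategy wins all remaining rounds. The events that a given value
  is exhausted are negatively correlated and have probability bounded below in terms of \<open>\<delta>\<close> and
  \<open>l\<close>, so by the second moment method one of them occurs with high probability once \<open>v\<close> is large.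

  Both estimates are carried out in one induction on the number of remaining cards: the
  conditional probability that all cards with values in \<open>A\<close> are gone when \<open>r\<close> cards remain is an
  explicit quotient of binomial coefficients, and it is a martingale.
\<close>

section \<open>Winning probability as a function of the remaining cards\<close>

definition win_ratio :: "strategy \<Rightarrow> nat multiset \<Rightarrow> real" where
  "win_ratio \<sigma> M = card {cs \<in> permutations_of_multiset M. wins \<sigma> cs} /
                   card (permutations_of_multiset M)"

lemma win_ratio_nonneg: "0 \<le> win_ratio \<sigma> M"
  by (simp add: win_ratio_def)

lemma card_permutations_of_multiset_pos: "card (permutations_of_multiset M) > 0"
  by (simp add: card_gt_0_iff)

lemma win_ratio_le_1: "win_ratio \<sigma> M \<le> 1"
  unfolding win_ratio_def using card_permutations_of_multiset_pos[of M]
  by (simp add: divide_le_eq card_mono)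

text \<open>Conditions on the first card turned; the named value has no summand because turning it
  loses at once.\<close>

lemma win_ratio_rec:
  assumes "M \<noteq> {#}"
  shows "win_ratio \<sigma> M =
    (\<Sum>x\<in>set_mset M - {\<sigma> []}. real (count M x) / size M * win_ratio (\<lambda>h. \<sigma> (x # h)) (M - {#x#}))"
proof -
  have "card {cs \<in> permutations_of_multiset (M - {#x#}). wins \<sigma>' cs} / card (permutations_of_multiset M)
      = real (count M x) / size M * win_ratio \<sigma>' (M - {#x#})" if "x \<in># M" for x \<sigma>'
    using that assms card_permutations_of_multiset_pos[of M]
    by (simp add: win_ratio_def real_card_permutations_of_multiset_remove)
  thus ?thesis
    by (subst win_ratio_def)
       (auto simp: card_wins_rec[OF assms] sum_divide_distrib intro!: sum.cong)
qed

lemma sum_count_eq_size: "(\<Sum>x\<in>set_mset M. real (count M x)) = size M"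
  by (simp add: size_multiset_overloaded_eq)

lemma sum_count_filter_eq_size:
  "(\<Sum>x\<in>{x\<in>set_mset M. P x}. real (count M x)) = size (filter_mset P M)"
  unfolding size_multiset_overloaded_eq by simp

text \<open>Keeping \<open>v\<close> separate from \<open>M\<close> lets an exhausted value go on
  competing while inductions remove cards.\<close>

definition greedy_on :: "nat \<Rightarrow> nat multiset \<Rightarrow> strategy \<Rightarrow> bool" where
  "greedy_on v M \<sigma> \<longleftrightarrow> (\<forall>h. mset h \<subset># M \<longrightarrow> least_frequent v (M - mset h) (\<sigma> h))"

lemma greedy_on_remove:
  assumes "greedy_on v M \<sigma>" "x \<in># M"
  shows "greedy_on v (M - {#x#}) (\<lambda>h. \<sigma> (x # h))"
  unfolding greedy_on_def
proof (intro allI impI)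
  fix h assume h: "mset h \<subset># M - {#x#}"
  obtain N where "M = add_mset x N" using assms(2) by (metis insert_DiffM)
  thus "least_frequent v (M - {#x#} - mset h) (\<sigma> (x # h))"
    using assms(1) h by (auto simp: greedy_on_def dest: spec[of _ "x # h"])
qed

text \<open>Value \<open>i\<close> stays at count 0, so every named value has count 0 among the
  remaining cards and cannot be turned.\<close>

lemma win_ratio_greedy_exhausted:
  assumes "greedy_on v M \<sigma>" "i < v" "count M i = 0"
  shows "win_ratio \<sigma> M = 1"
proof -
  have "wins \<sigma> cs" if "cs \<in> permutations_of_multiset M" for cs
    unfolding wins_def
  proof (intro allI impI)
    fix k assume k: "k < length cs"
    have cs: "mset cs = M" using that by (simp add: permutations_of_multiset_def)
    have "cs = take k cs @ cs ! k # drop (Suc k) cs" using k by (rule id_take_nth_drop)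
    hence M: "M = mset (take k cs) + add_mset (cs ! k) (mset (drop (Suc k) cs))"
      using cs by (metis mset.simps(2) mset_append)
    hence "mset (take k cs) \<subset># M" by (simp add: subset_mset.less_le)
    hence "least_frequent v (M - mset (take k cs)) (\<sigma> (take k cs))"
      using assms(1) by (simp add: greedy_on_def)
    hence "count (M - mset (take k cs)) (\<sigma> (take k cs)) \<le> count (M - mset (take k cs)) i"
      using assms(2) by (simp add: least_frequent_def)
    hence "count (M - mset (take k cs)) (\<sigma> (take k cs)) = 0" using assms(3) by simp
    moreover have "count (M - mset (take k cs)) (cs ! k) > 0" by (subst M) simp
    ultimately show "cs ! k \<noteq> \<sigma> (take k cs)" by auto
  qed
  hence "{cs \<in> permutations_of_multiset M. wins \<sigma> cs} = permutations_of_multiset M" by auto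
  thus ?thesis using card_permutations_of_multiset_pos[of M] by (simp add: win_ratio_def)
qed

section \<open>Exhaustion probabilities as martingales\<close>

text \<open>
  The probability that all cards with values in \<open>A\<close> have been turned when \<open>r\<close> cards of \<open>M\<close>
  remain.
\<close>

definition exhaust_prob :: "nat \<Rightarrow> nat multiset \<Rightarrow> nat set \<Rightarrow> real" where
  "exhaust_prob r M A = real (size {#x \<in># M. x \<notin> A#} choose r) / real (size M choose r)"

lemma real_binomial_absorb_comp:
  "(real n - real r) * real (n choose r) = real n * real ((n - 1) choose r)"
proof (cases "r \<le> n")
  case True
  thus ?thesis using binomial_absorb_comp[of n r]
    by (metis of_nat_diff of_nat_mult)
qed (simp add: binomial_eq_0)

text \<open>A card in \<open>A\<close> leaves the number \<open>q\<close> of cards outside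
  \<open>A\<close> unchanged, any other card lowers it by 1. Absorption then produces a factor
  \<open>n - r\<close> in numerator and denominator, which cancels.\<close>

lemma exhaust_prob_martingale:
  assumes "size M > r"
  shows "(\<Sum>x\<in>set_mset M. real (count M x) / size M * exhaust_prob r (M - {#x#}) A) =
           exhaust_prob r M A"
proof -
  define n where "n = size M"
  define q where "q = size {#x \<in># M. x \<notin> A#}"
  have n: "r < n" using assms by (simp add: n_def)
  have nq: "real (size {#x \<in># M. x \<in> A#}) = real n - real q"
    using multiset_partition[of M "\<lambda>x. x \<in> A"] unfolding n_def q_def
    by (metis add_diff_cancel_right' of_nat_add size_union)
  have card_rest: "size {#y \<in># M - {#x#}. y \<notin> A#} = (if x \<in> A then q else q - 1)"
    if "x \<in># M" for x
    using that by (simp add: q_def size_Diff_singleton)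
  have "(\<Sum>x\<in>set_mset M. real (count M x) / size M * exhaust_prob r (M - {#x#}) A) =
      (\<Sum>x\<in>set_mset M. real (count M x) * (if x \<in> A then real (q choose r) else real ((q - 1) choose r)))
        / (real n * real ((n - 1) choose r))"
    unfolding sum_divide_distrib
    by (intro sum.cong refl) (simp add: exhaust_prob_def card_rest size_Diff_singleton n_def del: filter_diff_mset)
  also have "(\<Sum>x\<in>set_mset M. real (count M x) *
        (if x \<in> A then real (q choose r) else real ((q - 1) choose r))) =
      (\<Sum>x\<in>{x \<in> set_mset M. x \<in> A}. real (count M x)) * real (q choose r) +
      (\<Sum>x\<in>{x \<in> set_mset M. x \<notin> A}. real (count M x)) * real ((q - 1) choose r)"
    unfolding if_distrib[of "(*) _"]
    by (subst sum.If_cases) (auto simp: sum_distrib_right Int_def Collect_neg_eq)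
  also have "\<dots> = (real n - real q) * real (q choose r) + real q * real ((q - 1) choose r)"
    unfolding sum_count_filter_eq_size nq by (simp add: q_def)
  also have "\<dots> = (real n - real r) * real (q choose r)"
    unfolding real_binomial_absorb_comp[symmetric] by (simp add: algebra_simps)
  also have "\<dots> / (real n * real ((n - 1) choose r)) = exhaust_prob r M A"
    unfolding real_binomial_absorb_comp[symmetric] exhaust_prob_def n_def[symmetric] q_def[symmetric]
    using n by simp
  finally show ?thesis .
qed

lemma exhaust_prob_final:
  assumes "size M = r"
  shows "exhaust_prob r M A = of_bool (A \<inter> set_mset M = {})"
proof (cases "A \<inter> set_mset M = {}")
  case True
  hence "{#x \<in># M. x \<notin> A#} = M" by (auto simp: filter_mset_eq_conv)
  thus ?thesis using True assms by (simp add: exhaust_prob_def)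
next
  case False
  hence "{#x \<in># M. x \<notin> A#} \<noteq> M" by (auto simp: filter_mset_eq_conv)
  hence "size {#x \<in># M. x \<notin> A#} < r"
    using mset_subset_size[of "{#x \<in># M. x \<notin> A#}" M] assms by (simp add: subset_mset.less_le)
  thus ?thesis using False by (simp add: exhaust_prob_def)
qed

text \<open>
  The conditional expectation of \<open>(N - \<mu>)\<^sup>2 / \<mu>\<^sup>2\<close>, where \<open>N\<close> is the number of values that are
  exhausted when \<open>r\<close> cards remain.
\<close>

definition second_moment :: "nat \<Rightarrow> nat \<Rightarrow> real \<Rightarrow> nat multiset \<Rightarrow> real" where
  "second_moment v r \<mu> M =
     ((\<Sum>i<v. \<Sum>j<v. exhaust_prob r M {i, j}) - 2 * \<mu> * (\<Sum>i<v. exhaust_prob r M {i}) + \<mu>\<^sup>2) / \<mu>\<^sup>2"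

text \<open>A linear combination of martingales plus a constant, averaged with weights of sum
  1.\<close>

lemma second_moment_martingale:
  assumes "size M > r"
  shows "(\<Sum>x\<in>set_mset M. real (count M x) / size M * second_moment v r \<mu> (M - {#x#})) =
           second_moment v r \<mu> M"
proof -
  let ?w = "\<lambda>x. real (count M x) / size M"
  let ?E = "\<lambda>f. \<Sum>x\<in>set_mset M. ?w x * f (M - {#x#})"
  have one: "(\<Sum>x\<in>set_mset M. ?w x) = 1"
    using assms by (auto simp flip: sum_divide_distrib simp: sum_count_eq_size)
  have singles: "(\<Sum>x\<in>set_mset M. \<Sum>i<v. ?w x * exhaust_prob r (M - {#x#}) (A i)) =
      (\<Sum>i<v. exhaust_prob r M (A i))" for A
    by (subst sum.swap) (simp only: exhaust_prob_martingale[OF assms])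
  have pairs: "(\<Sum>x\<in>set_mset M. \<Sum>i<v. \<Sum>j<v. ?w x * exhaust_prob r (M - {#x#}) {i, j}) =
      (\<Sum>i<v. \<Sum>j<v. exhaust_prob r M {i, j})"
    by (subst sum.swap) (simp only: singles)
  have "?E (second_moment v r \<mu>) =
      ((\<Sum>x\<in>set_mset M. \<Sum>i<v. \<Sum>j<v. ?w x * exhaust_prob r (M - {#x#}) {i, j})
      - 2 * \<mu> * (\<Sum>x\<in>set_mset M. \<Sum>i<v. ?w x * exhaust_prob r (M - {#x#}) {i})
      + (\<Sum>x\<in>set_mset M. ?w x) * \<mu>\<^sup>2) / \<mu>\<^sup>2"
    unfolding second_moment_def sum_distrib_left[symmetric] sum_distrib_right
    by (simp add: sum_divide_distrib sum_distrib_left sum.distrib sum_subtractf algebra_simps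
        add_divide_distrib diff_divide_distrib)
  also have "\<dots> = second_moment v r \<mu> M"
    unfolding one second_moment_def
    by (simp only: pairs singles mult_1)
  finally show ?thesis .
qed

text \<open>Every exhaustion probability has become an indicator, so the double sum is the square of
  the number of absent values.\<close>

lemma second_moment_final:
  assumes "size M = r"
  shows "second_moment v r \<mu> M = (real (card {i. i < v \<and> i \<notin># M}) - \<mu>)\<^sup>2 / \<mu>\<^sup>2"
proof -
  let ?N = "real (card {i. i < v \<and> i \<notin># M})"
  have single: "(\<Sum>i<v. of_bool (i \<notin># M) :: real) = ?N"
    by (simp add: Int_def)
  have "(\<Sum>i<v. \<Sum>j<v. exhaust_prob r M {i, j}) =
      (\<Sum>i<v. \<Sum>j<v. of_bool (i \<notin># M) * of_bool (j \<notin># M))"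
    by (intro sum.cong refl) (simp add: exhaust_prob_final[OF assms])
  also have "\<dots> = ?N * ?N"
    by (simp only: sum_product[symmetric] single)
  finally have "(\<Sum>i<v. \<Sum>j<v. exhaust_prob r M {i, j}) = ?N * ?N" .
  moreover have "(\<Sum>i<v. exhaust_prob r M {i}) = ?N"
    unfolding single[symmetric] by (intro sum.cong refl) (simp add: exhaust_prob_final[OF assms])
  ultimately show ?thesis
    by (simp add: second_moment_def power2_eq_square algebra_simps)
qed

section \<open>Lower bound for the winning probability\<close>

text \<open>Each round before \<open>r\<close> cards remain costs at most
  \<open>l / (real r + 1)\<close>. The martingale \<open>second_moment\<close> is carried along at
  no cost and pays for the final positions in which no value is exhausted.\<close>

lemma win_ratio_greedy_ge:
  assumes "greedy_on v M \<sigma>" "\<And>i. i < v \<Longrightarrow> count M i \<le> l" "size M \<ge> r" "\<mu> > 0"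
  shows "win_ratio \<sigma> M \<ge> 1 - (real (size M) - real r) * l / (real r + 1) - second_moment v r \<mu> M"
  using assms
proof (induction "size M - r" arbitrary: M \<sigma>)
  case 0
  hence size: "size M = r" by simp
  show ?case
  proof (cases "\<exists>i<v. i \<notin># M")
    case True
    then obtain i where "i < v" "count M i = 0" by (auto simp: not_in_iff)
    from win_ratio_greedy_exhausted[OF 0(2) this] show ?thesis
      by (simp add: size second_moment_final)
  next
    case False
    hence none: "{i. i < v \<and> i \<notin># M} = {}" by blast
    \<comment> \<open>Chebyshev: with no absent value the squared relative deviation is 1, so the
      claimed bound drops to 0.\<close>
    have "second_moment v r \<mu> M = 1"
      using \<open>\<mu> > 0\<close> unfolding second_moment_final[OF size] none by simp
    thus ?thesis using win_ratio_nonneg[of \<sigma> M] by (simp add: size)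
  qed
next
  case (Suc k)
  define n where "n = size M"
  have n: "n > r" "k = n - 1 - r" using Suc.hyps(2) by (auto simp: n_def)
  have M: "M \<noteq> {#}" using n by (auto simp: n_def)
  define a where "a = \<sigma> []"
  have "least_frequent v M a"
    using Suc.prems(1) M by (auto simp: greedy_on_def a_def subset_mset.less_le dest: spec[of _ "[]"])
  hence a: "count M a \<le> l" using Suc.prems(2) by (auto simp: least_frequent_def)
  let ?w = "\<lambda>x. real (count M x) / n"
  let ?W = "\<lambda>x. win_ratio (\<lambda>h. \<sigma> (x # h)) (M - {#x#})"
  let ?b = "1 - (real n - 1 - real r) * l / (real r + 1)"
  have one: "(\<Sum>x\<in>set_mset M. ?w x) = 1"
    using M by (auto simp flip: sum_divide_distrib simp: sum_count_eq_size n_def)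
  \<comment> \<open>The named value has at most \<open>l\<close> of the \<open>n\<close> cards, and
    \<open>n\<close> is at least \<open>r + 1\<close> here.\<close>
  have loss: "?w a * ?W a \<le> l / (real r + 1)"
  proof -
    have "?w a * ?W a \<le> ?w a * 1" by (intro mult_left_mono win_ratio_le_1) simp
    also have "\<dots> \<le> l / (real r + 1)" using a n by (simp, intro frac_le) auto
    finally show ?thesis .
  qed
  \<comment> \<open>The martingale property allows the induction hypothesis to be averaged over the
    next card.\<close>
  have "?b - second_moment v r \<mu> M =
      (\<Sum>x\<in>set_mset M. ?w x * (?b - second_moment v r \<mu> (M - {#x#})))"
    unfolding right_diff_distrib sum_subtractf sum_distrib_right[symmetric]
    using one second_moment_martingale[of r M v \<mu>] n(1) by (simp add: n_def)
  also have "\<dots> \<le> (\<Sum>x\<in>set_mset M. ?w x * ?W x)"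
  proof (intro sum_mono mult_left_mono)
    fix x assume x: "x \<in># M"
    have sz: "size (M - {#x#}) = n - 1" using x by (simp add: size_Diff_singleton n_def)
    have "1 - (real (size (M - {#x#})) - real r) * l / (real r + 1) - second_moment v r \<mu> (M - {#x#})
        \<le> ?W x"
    proof (rule Suc.hyps(1))
      show "k = size (M - {#x#}) - r" "r \<le> size (M - {#x#})" using n sz by auto
      show "greedy_on v (M - {#x#}) (\<lambda>h. \<sigma> (x # h))" using greedy_on_remove[OF Suc.prems(1) x] .
      show "count (M - {#x#}) i \<le> l" if "i < v" for i
        using Suc.prems(2)[OF that] by auto
    qed fact
    thus "?b - second_moment v r \<mu> (M - {#x#}) \<le> ?W x"
      using n(1) unfolding sz by (simp add: of_nat_diff)
  qed simp
  also have "\<dots> \<le> win_ratio \<sigma> M + l / (real r + 1)"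
  proof (cases "a \<in># M")
    case True
    have "(\<Sum>x\<in>set_mset M. ?w x * ?W x) = ?w a * ?W a + (\<Sum>x\<in>set_mset M - {a}. ?w x * ?W x)"
      using True by (intro sum.remove) auto
    thus ?thesis using loss unfolding win_ratio_rec[OF M] a_def n_def by linarith
  next
    case False
    hence "set_mset M - {a} = set_mset M" by auto
    thus ?thesis unfolding win_ratio_rec[OF M] a_def n_def by simp
  qed
  finally have "?b - second_moment v r \<mu> M \<le> win_ratio \<sigma> M + l / (real r + 1)" .
  moreover have "(real n - real r) * l / (real r + 1) =
      (real n - 1 - real r) * l / (real r + 1) + l / (real r + 1)"
    by (simp add: add_divide_distrib[symmetric] algebra_simps)
  ultimately show ?case unfolding n_def by linarith
qed

section \<open>Negative correlation and bounds for the moments\<close>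

text \<open>Raising \<open>N\<close> by 1 multiplies \<open>N choose r\<close> by
  \<open>(N + 1) / (N + 1 - r)\<close>, which decreases in \<open>N\<close>; so each step in
  \<open>a\<close> favours the right side. For \<open>q < r\<close> the left side is 0.\<close>

lemma binomial_log_concave:
  "real (q choose r) * real ((q + a + b) choose r) \<le> real ((q + a) choose r) * real ((q + b) choose r)"
proof (cases "r \<le> q")
  case True
  show ?thesis
  proof (induction a)
    case (Suc a)
    have step: "real (Suc N choose r) = real (N choose r) * (real (Suc N) / (real (Suc N) - real r))"
      if "N \<ge> q" for N
      using real_binomial_absorb_comp[of "Suc N" r] that True by (simp add: field_simps)
    let ?f = "\<lambda>N. real (Suc N) / (real (Suc N) - real r)"
    have "?f (q + a + b) \<le> ?f (q + a)"
      using True by (simp add: field_simps mult_left_mono)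
    moreover have "0 \<le> ?f (q + a + b)" using True by simp
    ultimately have "real (q choose r) * real ((q + a + b) choose r) * ?f (q + a + b) \<le>
        real ((q + a) choose r) * real ((q + b) choose r) * ?f (q + a)"
      by (intro mult_mono[OF Suc.IH]) auto
    thus ?case using step[of "q + a + b"] step[of "q + a"] by (simp add: mult_ac)
  qed simp
qed (simp add: binomial_eq_0)

lemma size_filter_mset_notin_insert:
  assumes "i \<notin> A"
  shows "size {#x \<in># M. x \<notin> A#} = size {#x \<in># M. x \<notin> insert i A#} + count M i"
  using assms by (induction M) auto

text \<open>With \<open>q\<close> cards of other values, the four binomials have upper entries
  \<open>q\<close>, \<open>q\<close> plus either count, and \<open>q\<close> plus both:
  log-concavity applies.\<close>

lemma exhaust_prob_neg_correlated:
  assumes "size M \<ge> r" "i \<noteq> j"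
  shows "exhaust_prob r M {i, j} \<le> exhaust_prob r M {i} * exhaust_prob r M {j}"
proof -
  define q where "q = size {#x \<in># M. x \<notin> {i, j}#}"
  have sz: "size {#x \<in># M. x \<notin> {i}#} = q + count M j" "size {#x \<in># M. x \<notin> {j}#} = q + count M i"
    using size_filter_mset_notin_insert[of j "{i}" M] size_filter_mset_notin_insert[of i "{j}" M] assms(2)
    by (simp_all add: q_def insert_commute conj_commute)
  have n: "size M = q + count M j + count M i"
    using size_filter_mset_notin_insert[of i "{}" M] sz by simp
  have pos: "real (size M choose r) > 0" using assms(1) by simp
  have "exhaust_prob r M {i, j} = real (q choose r) * real (size M choose r) / (real (size M choose r))\<^sup>2"
    using pos by (simp add: exhaust_prob_def q_def power2_eq_square)
  also have "\<dots> \<le> real ((q + count M j) choose r) * real ((q + count M i) choose r) / (real (size M choose r))\<^sup>2"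
    unfolding n by (intro divide_right_mono binomial_log_concave) simp
  also have "\<dots> = exhaust_prob r M {i} * exhaust_prob r M {j}"
    by (simp only: exhaust_prob_def sz power2_eq_square times_divide_times_eq)
  finally show ?thesis .
qed

lemma exhaust_prob_nonneg: "0 \<le> exhaust_prob r M A"
  by (simp add: exhaust_prob_def)

text \<open>Lowering \<open>N\<close> by 1 multiplies \<open>N choose r\<close> by
  \<open>(N - r) / N\<close>, which is at least \<open>\<beta>\<close> as long as at most
  \<open>l\<close> cards have been removed.\<close>

lemma binomial_minus_ge:
  fixes \<beta> :: real
  assumes "m \<le> l" "0 \<le> \<beta>" "\<beta> * n \<le> real n - real r - real l"
  shows "real ((n - m) choose r) \<ge> \<beta> ^ m * real (n choose r)"
  using assms(1)
proof (induction m)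
  case (Suc m)
  have mn: "real m + 1 + real r \<le> real n"
  proof -
    have "0 \<le> \<beta> * n" using assms(2) by simp
    thus ?thesis using assms(3) Suc.prems by linarith
  qed
  hence d: "real (n - m) = real n - real m" by (simp add: of_nat_diff)
  have "\<beta> * real (n - m) \<le> \<beta> * n" using assms(2) by (intro mult_left_mono) auto
  also have "\<dots> \<le> real (n - m) - real r" using assms(3) Suc.prems d by linarith
  finally have b: "\<beta> * real (n - m) \<le> real (n - m) - real r" .
  have "real (n - m) * (\<beta> ^ Suc m * real (n choose r)) =
      \<beta> * real (n - m) * (\<beta> ^ m * real (n choose r))" by simp
  also have "\<dots> \<le> (real (n - m) - real r) * real ((n - m) choose r)"
    using Suc assms(2) mn d by (intro mult_mono b) auto
  also have "\<dots> = real (n - m) * real ((n - Suc m) choose r)"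
    by (simp add: real_binomial_absorb_comp)
  finally show ?case using mn d by (subst (asm) mult_le_cancel_left_pos) auto
qed simp

lemma exhaust_prob_ge:
  fixes \<beta> :: real
  assumes "count M i \<le> l" "0 \<le> \<beta>" "\<beta> \<le> 1" "\<beta> * size M \<le> real (size M) - real r - real l" "r \<le> size M"
  shows "exhaust_prob r M {i} \<ge> \<beta> ^ l"
proof -
  have sz: "size {#x \<in># M. x \<notin> {i}#} = size M - count M i"
    using size_filter_mset_notin_insert[of i "{}" M] by simp
  have "\<beta> ^ l \<le> \<beta> ^ count M i" using assms by (intro power_decreasing) auto
  also have "\<dots> \<le> exhaust_prob r M {i}"
    using binomial_minus_ge[OF assms(1,2,4)] assms(5) unfolding exhaust_prob_def sz
    by (simp add: pos_le_divide_eq)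
  finally show ?thesis .
qed

text \<open>The variance is at most the mean: negative correlation handles distinct pairs, and the
  diagonal, where \<open>{i, i} = {i}\<close>, adds at most \<open>\<mu>\<close>.\<close>

lemma second_moment_le_inverse_mean:
  assumes "size M \<ge> r" and \<mu>: "\<mu> = (\<Sum>i<v. exhaust_prob r M {i})" "\<mu> > 0"
  shows "second_moment v r \<mu> M \<le> 1 / \<mu>"
proof -
  let ?p = "\<lambda>i. exhaust_prob r M {i}"
  have "(\<Sum>i<v. \<Sum>j<v. exhaust_prob r M {i, j}) \<le>
      (\<Sum>i<v. \<Sum>j<v. ?p i * ?p j + (if j = i then ?p i else 0))"
    using exhaust_prob_neg_correlated[OF assms(1)]
    by (intro sum_mono) (auto simp: exhaust_prob_nonneg)
  also have "\<dots> = \<mu> * \<mu> + \<mu>"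
    by (simp add: sum.distrib \<mu>(1) flip: sum_product)
  finally have "second_moment v r \<mu> M \<le> \<mu> / \<mu>\<^sup>2"
    unfolding second_moment_def \<mu>(1)[symmetric]
    by (intro divide_right_mono) (simp_all add: power2_eq_square)
  thus ?thesis using \<mu>(2) by (simp add: power2_eq_square)
qed

lemma size_deck_ge:
  assumes "\<And>i. i < length s \<Longrightarrow> s ! i > 0"
  shows "size (deck s) \<ge> length s"
proof -
  have "{..<length s} \<subseteq> set_mset (deck s)"
    using assms by (auto simp: count_deck simp flip: count_greater_zero_iff)
  hence "card {..<length s} \<le> card (set_mset (deck s))" by (intro card_mono) auto
  also have "card (set_mset (deck s)) \<le> (\<Sum>x\<in>set_mset (deck s). count (deck s) x)"
    using sum_mono[of "set_mset (deck s)" "\<lambda>_. 1" "count (deck s)"] by (simp add: Suc_le_eq)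
  finally show ?thesis by (simp add: size_multiset_overloaded_eq)
qed

section \<open>Choice of the parameters\<close>

theorem theorem2p6:
  fixes l :: int and \<epsilon> :: real
  assumes "\<epsilon> > 0"
  shows "\<exists>v\<^sub>0 :: nat. \<forall>s :: nat list.
           length s \<ge> v\<^sub>0 \<longrightarrow> (\<forall>i<length s. int (s ! i) \<le> l) \<longrightarrow> greedy_win_prob s \<ge> 1 - \<epsilon>"
proof -
  \<comment> \<open>The summand 1 keeps \<open>L\<close> positive, also for
    \<open>l \<le> 0\<close>, so that division by \<open>L\<close> is harmless.\<close>
  define L where "L = nat l + 1"
  \<comment> \<open>The bound 1/2 leaves at least half of the cards after the early rounds; the
    other bound limits the early loss to \<open>\<epsilon> / 2\<close>.\<close>
  define \<delta> where "\<delta> = min (1/2) (\<epsilon> / (4 * real L))"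
  \<comment> \<open>Halving \<open>\<delta>\<close> leaves room for the floor in \<open>t\<close>
    and for subtracting \<open>L\<close>, once \<open>\<delta> * n\<close> is at least
    \<open>2 * (L + 1)\<close>.\<close>
  define \<beta> where "\<beta> = \<delta> / 2"
  have L: "real L \<ge> 1" by (simp add: L_def)
  have \<delta>: "\<delta> > 0" "\<delta> \<le> 1/2" "\<delta> * L \<le> \<epsilon> / 4"
  proof -
    show "\<delta> > 0" using assms L by (simp add: \<delta>_def)
    have "\<delta> * L \<le> \<epsilon> / (4 * real L) * L" using L by (intro mult_right_mono) (auto simp: \<delta>_def)
    thus "\<delta> * L \<le> \<epsilon> / 4" using L by simp
  qed (simp add: \<delta>_def)
  have \<beta>: "\<beta> > 0" "\<beta> \<le> 1" using \<delta> by (auto simp: \<beta>_def)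
  \<comment> \<open>The first summand provides that room, the second makes the mean
    \<open>\<mu>\<close> at least \<open>2 / \<epsilon>\<close>.\<close>
  define v\<^sub>0 where "v\<^sub>0 = nat \<lceil>2 * (real L + 1) / \<delta>\<rceil> + nat \<lceil>2 / (\<epsilon> * \<beta> ^ L)\<rceil> + 1"
  have "greedy_win_prob s \<ge> 1 - \<epsilon>" if v: "length s \<ge> v\<^sub>0" and l: "\<forall>i<length s. int (s ! i) \<le> l" for s
  proof -
    define M where "M = deck s"
    define n where "n = size M"
    define v where "v = length s"
    define \<sigma> where "\<sigma> = greedy_strategy s"
    have g: "greedy_on v M \<sigma>"
      using is_greedy_greedy_strategy[of s] by (simp add: greedy_on_def is_greedy_def v_def M_def \<sigma>_def)
    have win: "greedy_win_prob s = win_ratio \<sigma> M"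
      by (simp add: greedy_win_prob_def win_prob_eq_card win_ratio_def \<sigma>_def M_def)
    have cnt: "count M i \<le> L" if "i < v" for i
      using l that by (auto simp: M_def count_deck L_def v_def)
    have vb: "real v \<ge> 2 * (real L + 1) / \<delta>" "real v \<ge> 2 / (\<epsilon> * \<beta> ^ L)" "v > 0"
      using v unfolding v\<^sub>0_def v_def by linarith+
    show ?thesis
    \<comment> \<open>A value without cards makes greedy win outright; otherwise the deck has at
      least \<open>v\<close> cards and grows with \<open>v\<close>.\<close>
    proof (cases "\<exists>i<v. count M i = 0")
      case True
      thus ?thesis using win_ratio_greedy_exhausted[OF g] assms by (auto simp: win)
    next
      case False
      have nv: "n \<ge> v"
        unfolding n_def M_def v_def
        by (rule size_deck_ge) (use False in \<open>auto simp: M_def v_def count_deck\<close>)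
      define t where "t = nat \<lfloor>\<delta> * n\<rfloor>"
      define r where "r = n - t"
      have t: "real t \<le> \<delta> * n" "real t \<ge> \<delta> * n - 1"
        using \<delta>(1) unfolding t_def by simp_all
      have "\<delta> * n \<le> 1/2 * n" using \<delta> by (intro mult_right_mono) auto
      hence t2: "real t \<le> n / 2" using t by linarith
      have r: "real r = real n - real t" using t2 by (simp add: r_def of_nat_diff)
      have rn: "r \<le> n" by (simp add: r_def)
      have dn: "2 * (real L + 1) \<le> \<delta> * n"
      proof -
        have "2 * (real L + 1) \<le> \<delta> * v" using vb(1) \<delta> by (simp add: field_simps)
        also have "\<dots> \<le> \<delta> * n" using nv \<delta> by simp
        finally show ?thesis .
      qed
      have "\<beta> * n \<le> real n - real r - real L"
        using dn t unfolding r \<beta>_def by simp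
      hence p: "exhaust_prob r M {i} \<ge> \<beta> ^ L" if "i < v" for i
        using exhaust_prob_ge[of M i L \<beta> r] cnt[OF that] \<beta> rn by (simp add: n_def)
      define \<mu> where "\<mu> = (\<Sum>i<v. exhaust_prob r M {i})"
      have "real v * \<beta> ^ L \<le> \<mu>"
        using sum_mono[of "{..<v}" "\<lambda>_. \<beta> ^ L" "\<lambda>i. exhaust_prob r M {i}"] p by (simp add: \<mu>_def)
      moreover have "2 / \<epsilon> \<le> real v * \<beta> ^ L"
        using vb(2) assms \<beta> by (simp add: field_simps)
      ultimately have \<mu>: "2 / \<epsilon> \<le> \<mu>" by linarith
      have \<mu>0: "\<mu> > 0" using less_le_trans[OF _ \<mu>] assms by simp
      have "second_moment v r \<mu> M \<le> 1 / \<mu>"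
        using second_moment_le_inverse_mean[OF _ \<mu>_def \<mu>0] rn by (simp add: n_def)
      also have "\<dots> \<le> \<epsilon> / 2" using \<mu> \<mu>0 assms by (simp add: field_simps)
      finally have late: "second_moment v r \<mu> M \<le> \<epsilon> / 2" .
      \<comment> \<open>Early loss: at most \<open>\<delta> * n\<close> rounds are played, and
        \<open>r\<close> is at least \<open>n / 2\<close>.\<close>
      have "(real n - real r) * L \<le> \<epsilon> / 2 * (real r + 1)"
      proof -
        have "(real n - real r) * L \<le> \<delta> * n * L" using t unfolding r by (intro mult_right_mono) auto
        also have "\<dots> = \<delta> * L * n" by simp
        also have "\<dots> \<le> \<epsilon> / 4 * n" using \<delta>(3) by (intro mult_right_mono) auto
        also have "\<dots> = \<epsilon> / 2 * (n / 2)" by simp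
        also have "\<dots> \<le> \<epsilon> / 2 * (real r + 1)" using assms t2 unfolding r by (intro mult_left_mono) auto
        finally show ?thesis .
      qed
      hence "(real n - real r) * L / (real r + 1) \<le> \<epsilon> / 2" by (simp add: divide_le_eq)
      with late win_ratio_greedy_ge[OF g cnt _ \<mu>0, of r] rn show ?thesis
        unfolding win n_def by linarith
    qed
  qed
  thus ?thesis by blast
qed

end
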